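(* Suppose $\|g(x)-g(y)\|\le\kappa\|x-y\|$ for all $x,y\in\mathbb{R}^d$ with $\kappa\le 1$, and $\|g'(x)-g'(y)\|\le\gamma\|x-y\|$ for all $x,y\in\mathbb{R}^d$ with $\gamma>0$. Let $\{x_t\}$ be generated by AAP($m$) with $S_t$ and $Y_t$ of full column rank for all $t\ge 0$, and suppose there exist constants $T>0$ and $M>0$ such that $\mathrm{cond}(S_t)\le M$ for all $t>T$. If $f_t\to 0$ as $t\to\infty$, then, as $t\to\infty$, $$E_t\to 0\qquad\text{and}\qquad B_t^*\to J_t ,$$ where $B_t^*\to J_t$ means $\|B_t^*-J_t\|\to 0$.
   Context: $g:\mathbb{R}^d\to\mathbb{R}^d$ is continuously differentiable, with Jacobian $g'$, and $f(x):=g(x)-x$. $\|\cdot\|$ is the Euclidean norm for vectors and the induced 2-norm for matrices; $\mathrm{cond}$ is the 2-norm condition number (ratio of largest to smallest singular value); $A^\dagger$ is the (left) pseudoinverse. AAP($m$) (Alternating Anderson-Picard method), with integer $1\le m\le d$, damping ratios $\beta_t\ge 0$ and starting point $x_0\in\mathbb{R}^d$: for $t=0,1,2,\dots$ set $x_t^0:=x_t$, $x_t^{\ell}:=g(x_t^{\ell-1})$ for $1\le\ell\le m$, $f_t^\ell:=f(x_t^\ell)$ for $0\le\ell\le m$, and $f_t:=f_t^0=f(x_t)$. Let $\alpha_t=(\alpha_t^0,\dots,\alpha_t^m)\in\mathbb{R}^{m+1}$ minimize $\|\sum_{\ell=0}^m\alpha^\ell f_t^\ell\|^2$ subject to $\sum_{\ell=0}^m\alpha^\ell=1$,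 and set $x_{t+1}:=(1-\beta_t)\sum_{\ell=0}^m\alpha_t^\ell x_t^\ell+\beta_t\sum_{\ell=0}^m\alpha_t^\ell g(x_t^\ell)$. $S_t:=[s_t^0,\dots,s_t^{m-1}]$ and $Y_t:=[y_t^0,\dots,y_t^{m-1}]$ in $\mathbb{R}^{d\times m}$, where $s_t^\ell:=x_t^{\ell+1}-x_t^\ell$ and $y_t^\ell:=f_t^{\ell+1}-f_t^\ell$. $\mathbb{B}_t:=\{B\in\mathbb{R}^{d\times d}: B S_t=Y_t\}$ and $J_t:=f'(x_t)$. $E_t:=B_t^*-J_t$, where $B_t^*$ is the minimizer of $\|B-J_t\|$ over $B\in\mathbb{B}_t$ for which $E_t=(Y_t-J_tS_t)S_t^\dagger$. *)

theory Defs
  imports "HOL-Analysis.Analysis"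
begin

definition spectral_norm :: "real^'n^'k \<Rightarrow> real" where
  "spectral_norm A = onorm ((*v) A)"

(* Square roots of the eigenvalues of A\<^sup>T A. For matrices with at least as many rows as columns
   (the only case used below) this is the usual notion; for wide matrices it contains extra zeros. *)
definition singular_values :: "real^'n^'k \<Rightarrow> real set" where
  "singular_values A =
     sqrt ` {l. \<exists>v. v \<noteq> 0 \<and> (transpose A ** A) *v v = l *\<^sub>R v}"

(* Meaningful only for full column rank; otherwise the smallest singular value is 0
   and the quotient is the junk value 0. *)
definition cond_number :: "real^'n^'k \<Rightarrow> real" where
  "cond_number A = Max (singular_values A) / Min (singular_values A)"

(* Left pseudoinverse; meaningful only for full column rank. *)
definition left_pinv :: "real^'n^'k \<Rightarrow> real^'k^'n" where
  "left_pinv A = matrix_inv (transpose A ** A) ** transpose A"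

definition residual :: "(real^'d \<Rightarrow> real^'d) \<Rightarrow> real^'d \<Rightarrow> real^'d" where
  "residual g x = g x - x"

definition picard :: "(real^'d \<Rightarrow> real^'d) \<Rightarrow> real^'d \<Rightarrow> nat \<Rightarrow> real^'d" where
  "picard g x l = (g ^^ l) x"

definition is_anderson_weights ::
    "(real^'d \<Rightarrow> real^'d) \<Rightarrow> nat \<Rightarrow> real^'d \<Rightarrow> (nat \<Rightarrow> real) \<Rightarrow> bool" where
  "is_anderson_weights g m x a \<longleftrightarrow>
     is_arg_min (\<lambda>b. (norm (\<Sum>l\<le>m. b l *\<^sub>R residual g (picard g x l)))\<^sup>2)
                (\<lambda>b. (\<Sum>l\<le>m. b l) = 1) a"

(* x is a sequence generated by AAP(m) with damping ratios \<beta>, from the starting point x 0;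
   of each weight function only the values at 0, ..., m matter. *)
definition AAP_sequence ::
    "(real^'d \<Rightarrow> real^'d) \<Rightarrow> nat \<Rightarrow> (nat \<Rightarrow> real) \<Rightarrow> (nat \<Rightarrow> real^'d) \<Rightarrow> bool" where
  "AAP_sequence g m \<beta> x \<longleftrightarrow>
     (\<forall>t. \<exists>a. is_anderson_weights g m (x t) a \<and>
        x (Suc t) = (1 - \<beta> t) *\<^sub>R (\<Sum>l\<le>m. a l *\<^sub>R picard g (x t) l)
                    + \<beta> t *\<^sub>R (\<Sum>l\<le>m. a l *\<^sub>R g (picard g (x t) l)))"

(* Position (counted from 0) of an index in the linearly ordered index type. *)
definition index_pos :: "'m::{finite,linorder} \<Rightarrow> nat" where
  "index_pos j = card {i. i < j}"

(* In the following two matrices m = CARD('m), and the column with index j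
   is s_t^l, respectively y_t^l, where l = index_pos j. *)
definition S_matrix :: "(real^'d \<Rightarrow> real^'d) \<Rightarrow> real^'d \<Rightarrow> real^('m::{finite,linorder})^'d" where
  "S_matrix g x =
     (\<chi> i j. (picard g x (Suc (index_pos j)) - picard g x (index_pos j)) $ i)"

definition Y_matrix :: "(real^'d \<Rightarrow> real^'d) \<Rightarrow> real^'d \<Rightarrow> real^('m::{finite,linorder})^'d" where
  "Y_matrix g x =
     (\<chi> i j. (residual g (picard g x (Suc (index_pos j)))
              - residual g (picard g x (index_pos j))) $ i)"

definition secant_matrices :: "real^'m^'d \<Rightarrow> real^'m^'d \<Rightarrow> (real^'d^'d) set" where
  "secant_matrices S Y = {B. B ** S = Y}"

(* Minimizers in the spectral norm need not be unique; the last conjunct selects the intended one. *)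
definition B_star :: "real^'m^'d \<Rightarrow> real^'m^'d \<Rightarrow> real^'d^'d \<Rightarrow> real^'d^'d" where
  "B_star S Y J =
     (THE B. is_arg_min (\<lambda>B. spectral_norm (B - J)) (\<lambda>B. B \<in> secant_matrices S Y) B \<and>
             B - J = (Y - J ** S) ** left_pinv S)"

end

theory Submission
  imports Defs
begin

text \<open>
  Since \<open>g\<close> is nonexpansive, the Picard iterates \<open>x_t^l\<close> stay within distance \<open>m \<parallel>f_t\<parallel>\<close> of \<open>x_t\<close>.
  The Lipschitz continuity of the Jacobian then bounds each column of \<open>Y_t - J_t S_t\<close> by
  \<open>\<gamma> m \<parallel>f_t\<parallel>\<close> times the norm of the corresponding column of \<open>S_t\<close>. As the norm of \<open>S_t\<close> times that
  of its pseudoinverse is at most \<open>cond S_t\<close>, this gives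
  \<open>\<parallel>E_t\<parallel> \<le> \<gamma> m\<^sup>2 \<parallel>f_t\<parallel> cond S_t \<longrightarrow> 0\<close>.
\<close>

section \<open>The spectral norm\<close>

lemma norm_mult_spectral_norm: "norm (A *v v) \<le> spectral_norm A * norm v"
  for A :: "real^'n^'k"
  unfolding spectral_norm_def by (rule onorm) (rule matrix_vector_mul_bounded_linear)

lemma spectral_norm_nonneg: "0 \<le> spectral_norm A"
  for A :: "real^'n^'k"
  unfolding spectral_norm_def by (rule onorm_pos_le) (rule matrix_vector_mul_bounded_linear)

lemma spectral_norm_le:
  fixes A :: "real^'n^'k"
  assumes "\<And>v. norm (A *v v) \<le> b * norm v"
  shows "spectral_norm A \<le> b"
  unfolding spectral_norm_def using assms by (rule onorm_le)

lemma spectral_norm_mult: "spectral_norm (A ** B) \<le> spectral_norm A * spectral_norm B"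
  for A :: "real^'n^'k" and B :: "real^'l^'n"
proof (rule spectral_norm_le)
  fix v
  have "norm ((A ** B) *v v) = norm (A *v (B *v v))"
    by (simp add: matrix_vector_mul_assoc)
  also have "\<dots> \<le> spectral_norm A * norm (B *v v)"
    by (rule norm_mult_spectral_norm)
  also have "\<dots> \<le> spectral_norm A * (spectral_norm B * norm v)"
    by (intro mult_left_mono norm_mult_spectral_norm spectral_norm_nonneg)
  finally show "norm ((A ** B) *v v) \<le> spectral_norm A * spectral_norm B * norm v"
    by (simp add: mult.assoc)
qed

text \<open>\<open>A *v v\<close> combines the columns of \<open>A\<close> with coefficients at most
  \<open>norm v\<close> in absolute value. The triangle inequality costs the factor
  \<open>CARD('n)\<close>, harmless because the number of columns stays fixed in the limit.\<close>

lemma spectral_norm_le_columns: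
  fixes A :: "real^'n^'k"
  assumes "\<And>j. norm (column j A) \<le> b"
  shows "spectral_norm A \<le> real CARD('n) * b"
proof (rule spectral_norm_le)
  fix v :: "real^'n"
  have "norm (A *v v) = norm (\<Sum>j\<in>UNIV. v $ j *\<^sub>R column j A)"
    by (simp add: matrix_mult_sum scalar_mult_eq_scaleR)
  also have "\<dots> \<le> (\<Sum>j\<in>(UNIV::'n set). norm v * b)"
    by (intro sum_norm_le) (simp add: mult_mono component_le_norm_cart assms)
  finally show "norm (A *v v) \<le> real CARD('n) * b * norm v"
    by (simp add: algebra_simps)
qed

text \<open>Every entry is bounded by the spectral norm, and matrices converge entrywise.\<close>

lemma spectral_norm_tendsto_zero_imp:
  fixes A :: "nat \<Rightarrow> real^'n^'k"
  assumes "(\<lambda>t. spectral_norm (A t)) \<longlonglongrightarrow> 0"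
  shows "A \<longlonglongrightarrow> 0"
proof (intro vec_tendstoI)
  fix i j
  have "norm (A t $ i $ j) \<le> spectral_norm (A t)" for t
    using matrix_component_le_onorm[of "A t" i j] by (simp add: spectral_norm_def)
  then have "(\<lambda>t. A t $ i $ j) \<longlonglongrightarrow> 0"
    by (intro Lim_null_comparison[OF _ assms]) simp
  then show "((\<lambda>t. A t $ i $ j) \<longlongrightarrow> 0 $ i $ j) sequentially"
    by simp
qed

section \<open>Singular values\<close>

text \<open>\<open>transpose A\<close> is the adjoint of \<open>A\<close>. Symmetry and positive
  semidefiniteness of the Gram matrix are both read off from this identity.\<close>

lemma inner_gram: "u \<bullet> ((transpose A ** A) *v v) = (A *v u) \<bullet> (A *v v)"
  for A :: "real^'n^'k"
proof -
  have "u \<bullet> ((transpose A ** A) *v v) = ((A *v v) v* A) \<bullet> u"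
    by (simp add: inner_commute flip: matrix_vector_mul_assoc)
  also have "\<dots> = (A *v v) \<bullet> (A *v u)"
    by (rule dot_lmul_matrix)
  finally show ?thesis
    by (simp only: inner_commute)
qed

text \<open>A null vector minimizes the nonnegative quadratic form of \<open>h\<close>, so the
  gradient \<open>2 h v\<close> vanishes there. This turns extremal points of
  \<open>norm (A *v v)\<close> on the unit sphere into eigenvectors of the Gram matrix.\<close>

lemma symmetric_psd_null_vector:
  fixes h :: "'a::real_inner \<Rightarrow> 'a"
  assumes "linear h" and sym: "\<And>u v. u \<bullet> h v = h u \<bullet> v"
    and psd: "\<And>v. 0 \<le> v \<bullet> h v" and null: "v \<bullet> h v = 0"
  shows "h v = 0"
proof (rule ccontr)
  interpret linear h by fact
  assume "h v \<noteq> 0"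
  define w where "w = h v"
  define a where "a = w \<bullet> w"
  define c where "c = w \<bullet> h w"
  have a: "a > 0"
    using \<open>h v \<noteq> 0\<close> by (simp add: a_def w_def)
  have c: "c \<ge> 0"
    unfolding c_def by (rule psd)
  have expand: "(v + t *\<^sub>R w) \<bullet> h (v + t *\<^sub>R w) = 2 * t * a + t * t * c" for t
    using null sym[of v w]
    by (simp add: add scale inner_add_left inner_add_right a_def c_def w_def inner_commute)
  \<comment> \<open>The form at \<open>v + t *\<^sub>R w\<close> is negative for small negative
    \<open>t\<close>, its linear term being \<open>2 * t * a\<close> with \<open>a > 0\<close>. The
    denominator \<open>c + 1\<close> stays positive even if \<open>c = 0\<close>.\<close>
  define t where "t = - a / (c + 1)"
  have "2 * t * a + t * t * c = - (a * a) * (c + 2) / ((c + 1) * (c + 1))"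
    using c by (simp add: t_def divide_simps) (simp add: algebra_simps)
  also have "\<dots> < 0"
    using a c by (intro divide_neg_pos mult_neg_pos mult_pos_pos) auto
  finally show False
    using psd[of "v + t *\<^sub>R w"] expand[of t] by linarith
qed

text \<open>Eigenvectors of the symmetric Gram matrix for distinct eigenvalues are orthogonal, and a
  pairwise orthogonal set is finite. Hence \<open>Max\<close> and \<open>Min\<close> in
  \<open>cond_number\<close> are attained once the set is nonempty.\<close>

lemma finite_singular_values: "finite (singular_values A)"
  for A :: "real^'n^'k"
proof -
  let ?G = "transpose A ** A"
  define L where "L = {l. \<exists>v. v \<noteq> 0 \<and> ?G *v v = l *\<^sub>R v}"
  have "\<forall>l\<in>L. \<exists>v. v \<noteq> 0 \<and> ?G *v v = l *\<^sub>R v"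
    by (simp add: L_def)
  then obtain e where e: "\<And>l. l \<in> L \<Longrightarrow> e l \<noteq> 0 \<and> ?G *v e l = l *\<^sub>R e l"
    by metis
  have orth: "e k \<bullet> e l = 0" if "k \<in> L" "l \<in> L" "k \<noteq> l" for k l
  proof -
    have "l * (e k \<bullet> e l) = k * (e k \<bullet> e l)"
      using inner_gram[of "e k" A "e l"] inner_gram[of "e l" A "e k"] e that
      by (simp add: inner_commute)
    then show ?thesis
      using that by simp
  qed
  \<comment> \<open>An eigenvector shared by two eigenvalues would be orthogonal to itself, hence
    zero.\<close>
  have "inj_on e L"
    by (rule inj_onI) (metis e inner_eq_zero_iff orth)
  moreover have "finite (e ` L)"
    by (rule pairwise_orthogonal_imp_finite)
      (auto simp: pairwise_def orthogonal_def intro: orth)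
  ultimately have "finite L"
    by (rule finite_imageD[rotated])
  then show ?thesis
    unfolding singular_values_def L_def by simp
qed

text \<open>By compactness \<open>norm (A *v v)\<close> attains a maximum \<open>s\<close> on the
  unit sphere. The maximizer is a null vector of the positive semidefinite map \<open>h\<close>,
  that is \<open>s\<^sup>2\<close> times the identity minus the Gram matrix, hence an eigenvector
  for \<open>s\<^sup>2\<close>.\<close>

lemma singular_value_max:
  fixes A :: "real^'n^'k"
  obtains s where "s \<in> singular_values A" and "\<And>v. norm (A *v v) \<le> s * norm v"
    and "0 \<le> s"
proof -
  let ?G = "transpose A ** A"
  have "continuous_on (sphere 0 1) (\<lambda>v. norm (A *v v))"
    by (intro continuous_intros linear_continuous_on matrix_vector_mul_bounded_linear)
  then obtain v0 where v0: "norm v0 = 1"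
    and sup: "\<And>v. norm v = 1 \<Longrightarrow> norm (A *v v) \<le> norm (A *v v0)"
    using continuous_attains_sup[of "sphere (0::real^'n) 1" "\<lambda>v. norm (A *v v)"] by auto
  define s where "s = norm (A *v v0)"
  have bound: "norm (A *v v) \<le> s * norm v" for v
  proof (cases "v = 0")
    case False
    then show ?thesis
      using sup[of "v /\<^sub>R norm v"]
      by (simp add: s_def matrix_vector_mult_scaleR divide_simps)
  qed simp
  define h where "h v = s\<^sup>2 *\<^sub>R v - ?G *v v" for v
  have "h v0 = 0"
  proof (rule symmetric_psd_null_vector[where h = h])
    show "linear h"
      unfolding h_def by (intro linear_compose_sub linear_scale_self matrix_vector_mul_linear)
    show "u \<bullet> h v = h u \<bullet> v" for u v
      using inner_gram[of u A v] inner_gram[of v A u]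
      by (simp add: h_def inner_diff_left inner_diff_right inner_commute)
    show "0 \<le> v \<bullet> h v" for v
      using power_mono[OF bound[of v] norm_ge_zero, of 2]
      by (simp add: h_def inner_diff_right inner_gram power_mult_distrib flip: power2_norm_eq_inner)
    show "v0 \<bullet> h v0 = 0"
      by (simp add: h_def inner_diff_right inner_gram s_def v0 flip: power2_norm_eq_inner)
  qed
  then have "?G *v v0 = s\<^sup>2 *\<^sub>R v0"
    by (simp add: h_def)
  moreover have "v0 \<noteq> 0" "s \<ge> 0"
    using v0 by (auto simp: s_def)
  ultimately have "s \<in> singular_values A"
    unfolding singular_values_def by (intro image_eqI[of _ _ "s\<^sup>2"]) auto
  then show ?thesis
    using that bound \<open>s \<ge> 0\<close> by blast
qed

text \<open>Mirror image of the maximum: the sign of \<open>h\<close> is reversed and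
  \<open>v0\<close> is a minimizer. The value may be 0 here; positivity will come from
  injectivity.\<close>

lemma singular_value_min:
  fixes A :: "real^'n^'k"
  obtains s where "s \<in> singular_values A" and "\<And>v. s * norm v \<le> norm (A *v v)"
proof -
  let ?G = "transpose A ** A"
  have "continuous_on (sphere 0 1) (\<lambda>v. norm (A *v v))"
    by (intro continuous_intros linear_continuous_on matrix_vector_mul_bounded_linear)
  then obtain v0 where v0: "norm v0 = 1"
    and inf: "\<And>v. norm v = 1 \<Longrightarrow> norm (A *v v0) \<le> norm (A *v v)"
    using continuous_attains_inf[of "sphere (0::real^'n) 1" "\<lambda>v. norm (A *v v)"] by auto
  define s where "s = norm (A *v v0)"
  have bound: "s * norm v \<le> norm (A *v v)" for v
  proof (cases "v = 0")
    case False
    then show ?thesis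
      using inf[of "v /\<^sub>R norm v"]
      by (simp add: s_def matrix_vector_mult_scaleR divide_simps)
  qed simp
  have s: "s \<ge> 0"
    by (simp add: s_def)
  define h where "h v = ?G *v v - s\<^sup>2 *\<^sub>R v" for v
  have "h v0 = 0"
  proof (rule symmetric_psd_null_vector[where h = h])
    show "linear h"
      unfolding h_def by (intro linear_compose_sub linear_scale_self matrix_vector_mul_linear)
    show "u \<bullet> h v = h u \<bullet> v" for u v
      using inner_gram[of u A v] inner_gram[of v A u]
      by (simp add: h_def inner_diff_left inner_diff_right inner_commute)
    show "0 \<le> v \<bullet> h v" for v
      using power_mono[OF bound[of v], of 2] s
      by (simp add: h_def inner_diff_right inner_gram power_mult_distrib flip: power2_norm_eq_inner)
    show "v0 \<bullet> h v0 = 0"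
      by (simp add: h_def inner_diff_right inner_gram s_def v0 flip: power2_norm_eq_inner)
  qed
  then have "?G *v v0 = s\<^sup>2 *\<^sub>R v0"
    by (simp add: h_def)
  moreover have "v0 \<noteq> 0"
    using v0 by auto
  ultimately have "s \<in> singular_values A"
    unfolding singular_values_def using s by (intro image_eqI[of _ _ "s\<^sup>2"]) auto
  then show ?thesis
    using that bound by blast
qed

section \<open>The left pseudoinverse\<close>

text \<open>The Gram matrix has the same kernel as \<open>A\<close>, since its quadratic form is the
  squared norm of \<open>A *v v\<close>.\<close>

lemma gram_invertible:
  fixes A :: "real^'n^'k"
  assumes "inj ((*v) A)"
  shows "invertible (transpose A ** A)"
proof -
  have "v = 0" if "(transpose A ** A) *v v = 0" for v
  proof -
    have "A *v v = 0"
      using inner_gram[of v A v] that by simp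
    then show ?thesis
      using assms by (metis injD matrix_vector_mult_0_right)
  qed
  then show ?thesis
    by (simp add: invertible_left_inverse matrix_left_invertible_ker)
qed

lemma matrix_inv_mult:
  fixes A :: "real^'n^'k"
  assumes "invertible A"
  shows "A ** matrix_inv A = mat 1" "matrix_inv A ** A = mat 1"
  using someI_ex[OF assms[unfolded invertible_def]] by (simp_all add: matrix_inv_def)

lemma left_pinv_mult:
  fixes A :: "real^'n^'k"
  assumes "inj ((*v) A)"
  shows "left_pinv A ** A = mat 1"
  using matrix_inv_mult(2)[OF gram_invertible[OF assms]]
  by (simp add: left_pinv_def matrix_mul_assoc)

text \<open>\<open>A ** left_pinv A\<close> is the orthogonal projection onto the column space of \<open>A\<close>.\<close>

lemma norm_mult_left_pinv_le:
  fixes A :: "real^'n^'k"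
  assumes "inj ((*v) A)"
  shows "norm (A *v (left_pinv A *v y)) \<le> norm y"
proof -
  define w where "w = left_pinv A *v y"
  \<comment> \<open>\<open>w\<close> solves the normal equations of the least squares problem for
    \<open>y\<close>; pairing them with \<open>w\<close> gives the projection identity
    below.\<close>
  have "(transpose A ** A) *v w = (transpose A ** A ** matrix_inv (transpose A ** A)) *v (transpose A *v y)"
    by (simp add: w_def left_pinv_def matrix_vector_mul_assoc matrix_mul_assoc del: transpose_matrix_vector)
  also have "\<dots> = transpose A *v y"
    using matrix_inv_mult(1)[OF gram_invertible[OF assms]] by simp
  finally have "(A *v w) \<bullet> (A *v w) = w \<bullet> (transpose A *v y)"
    by (metis inner_gram)
  also have "\<dots> = (A *v w) \<bullet> y"
    by (metis dot_lmul_matrix transpose_matrix_vector inner_commute)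
  finally have "norm (A *v w) * norm (A *v w) \<le> norm (A *v w) * norm y"
    by (metis norm_cauchy_schwarz power2_norm_eq_inner power2_eq_square)
  then show ?thesis
    unfolding w_def[symmetric] by (cases "A *v w = 0") simp_all
qed

text \<open>The norm of \<open>A\<close> is at most \<open>s\<close>. The lower bound
  \<open>r\<close> applied to \<open>left_pinv A *v y\<close>, with the projection bound, shows that
  the norm of the pseudoinverse is at most \<open>1 / r\<close>.\<close>

lemma spectral_norm_mult_left_pinv_le_cond_number:
  fixes A :: "real^'n^'k"
  assumes inj: "inj ((*v) A)"
  shows "spectral_norm A * spectral_norm (left_pinv A) \<le> cond_number A"
proof -
  obtain s where s: "s \<in> singular_values A" "\<And>v. norm (A *v v) \<le> s * norm v" "0 \<le> s"
    using singular_value_max[of A] by blast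
  obtain r where r: "r \<in> singular_values A" "\<And>v. r * norm v \<le> norm (A *v v)"
    using singular_value_min[of A] by blast
  \<comment> \<open>Injectivity excludes the singular value 0, so no quotient below takes the
    default value of division by zero.\<close>
  have pos: "0 < q" if q: "q \<in> singular_values A" for q
  proof -
    obtain l v where l: "q = sqrt l" "v \<noteq> 0" "(transpose A ** A) *v v = l *\<^sub>R v"
      using q unfolding singular_values_def by blast
    have "A *v v \<noteq> 0"
      using inj l(2) by (metis injD matrix_vector_mult_0_right)
    then have "0 < l * (v \<bullet> v)"
      using inner_gram[of v A v] l(3) by simp
    then show ?thesis
      using l by (metis inner_gt_zero_iff real_sqrt_gt_zero zero_less_mult_pos2)
  qed
  have fin: "finite (singular_values A)"
    by (rule finite_singular_values)
  have "spectral_norm (left_pinv A) \<le> 1 / r"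
  proof (rule spectral_norm_le)
    fix y
    have "r * norm (left_pinv A *v y) \<le> norm y"
      using r(2) norm_mult_left_pinv_le[OF inj] order_trans by blast
    then show "norm (left_pinv A *v y) \<le> 1 / r * norm y"
      using pos[OF r(1)] by (simp add: field_simps)
  qed
  moreover have "spectral_norm A \<le> s"
    by (rule spectral_norm_le) (rule s(2))
  ultimately have "spectral_norm A * spectral_norm (left_pinv A) \<le> s * (1 / r)"
    using s(3) by (intro mult_mono spectral_norm_nonneg)
  \<comment> \<open>Membership of \<open>s\<close> and \<open>r\<close> in the set of singular
    values suffices to compare them with its maximum and minimum.\<close>
  also have "s * (1 / r) \<le> Max (singular_values A) * (1 / Min (singular_values A))"
  proof (intro mult_mono)
    show sM: "s \<le> Max (singular_values A)"
      using fin s(1) by simp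
    then show "0 \<le> Max (singular_values A)"
      using s(3) by simp
    have "Min (singular_values A) \<in> singular_values A"
      using fin r(1) by (intro Min_in) auto
    moreover have "Min (singular_values A) \<le> r"
      using fin r(1) by simp
    ultimately show "1 / r \<le> 1 / Min (singular_values A)"
      using pos pos[OF r(1)] by (intro divide_left_mono mult_pos_pos) auto
    show "0 \<le> 1 / r"
      using pos[OF r(1)] by simp
  qed
  finally show ?thesis
    by (simp add: cond_number_def)
qed

section \<open>The secant matrix closest to \<open>J\<close>\<close>

lemma matrix_mult_add_rdistrib: "(A + B) ** C = A ** C + B ** C"
  for A B :: "real^'n^'k" and C :: "real^'l^'n"
  by (simp add: matrix_matrix_mult_def vec_eq_iff sum.distrib distrib_right)

lemma matrix_mult_diff_rdistrib: "(A - B) ** C = A ** C - B ** C"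
  for A B :: "real^'n^'k" and C :: "real^'l^'n"
  by (simp add: matrix_matrix_mult_def vec_eq_iff sum_subtractf left_diff_distrib)

text \<open>Since \<open>Y = B ** S\<close> for every feasible \<open>B\<close>, the matrix
  \<open>?E\<close> is \<open>B - J\<close> times the projection \<open>S ** left_pinv S\<close>, of
  norm at most 1. Thus \<open>J + ?E\<close> is a minimizer.\<close>

lemma B_star_diff:
  fixes S Y :: "real^'m^'d"
  assumes inj: "inj ((*v) S)"
  shows "B_star S Y J - J = (Y - J ** S) ** left_pinv S"
proof -
  let ?E = "(Y - J ** S) ** left_pinv S"
  have "(J + ?E) ** S = J ** S + (Y - J ** S) ** (left_pinv S ** S)"
    by (simp add: matrix_mult_add_rdistrib matrix_mul_assoc)
  then have feasible: "J + ?E \<in> secant_matrices S Y"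
    by (simp add: left_pinv_mult[OF inj] secant_matrices_def)
  have "spectral_norm (S ** left_pinv S) \<le> 1"
    by (rule spectral_norm_le) (use norm_mult_left_pinv_le[OF inj] in \<open>simp add: matrix_vector_mul_assoc\<close>)
  moreover have "?E = (B - J) ** (S ** left_pinv S)" if "B \<in> secant_matrices S Y" for B
    using that by (simp add: secant_matrices_def matrix_mul_assoc matrix_mult_diff_rdistrib)
  ultimately have "spectral_norm ?E \<le> spectral_norm (B - J)" if "B \<in> secant_matrices S Y" for B
    using that spectral_norm_mult[of "B - J" "S ** left_pinv S"]
    by (smt (verit) mult_left_le spectral_norm_nonneg)
  then have "is_arg_min (\<lambda>B. spectral_norm (B - J)) (\<lambda>B. B \<in> secant_matrices S Y) (J + ?E)"
    using feasible by (simp add: is_arg_min_linorder)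
  \<comment> \<open>The prescribed value of \<open>B - J\<close> in the definition already
    determines \<open>B\<close>, so the description is unique even where minimizers are not.\<close>
  then have "B_star S Y J = J + ?E"
    unfolding B_star_def by (intro the_equality) (auto simp: algebra_simps)
  then show ?thesis
    by simp
qed

section \<open>Picard iterates\<close>

lemma picard_Suc: "picard g z (Suc l) = g (picard g z l)"
  by (simp add: picard_def)

text \<open>The residual at an iterate is the next Picard step, and a nonexpansive map does not
  lengthen steps.\<close>

lemma norm_residual_picard_le:
  assumes nonexp: "\<And>y z. norm (g y - g z) \<le> norm (y - z)"
  shows "norm (residual g (picard g z l)) \<le> norm (residual g z)"
proof (induction l)
  case (Suc l)
  have "norm (residual g (picard g z (Suc l))) \<le> norm (residual g (picard g z l))"
    using nonexp[of "g (picard g z l)" "picard g z l"] by (simp add: picard_Suc residual_def)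
  with Suc show ?case
    by simp
qed (simp add: picard_def)

text \<open>The difference telescopes into \<open>l\<close> Picard steps, none longer than the
  first.\<close>

lemma norm_picard_diff_le:
  assumes nonexp: "\<And>y z. norm (g y - g z) \<le> norm (y - z)"
  shows "norm (picard g z l - z) \<le> real l * norm (residual g z)"
proof (induction l)
  case (Suc l)
  have "picard g z (Suc l) - z = residual g (picard g z l) + (picard g z l - z)"
    by (simp add: picard_Suc residual_def)
  then have "norm (picard g z (Suc l) - z) \<le> norm (residual g (picard g z l)) + norm (picard g z l - z)"
    by (metis norm_triangle_ineq)
  with Suc norm_residual_picard_le[of g z l, OF nonexp] show ?case
    by (simp add: algebra_simps)
qed (simp add: picard_def)

lemma index_pos_less: "index_pos j < CARD('m)" for j :: "'m::{finite,linorder}"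
  unfolding index_pos_def by (rule psubset_card_mono) auto

section \<open>Linearization error of the residual\<close>

lemma residual_has_derivative:
  assumes "g differentiable (at z)"
  shows "(residual g has_derivative (\<lambda>h. jacobian g (at z) *v h - h)) (at z)"
  using has_derivative_diff[OF jacobian_works[THEN iffD1, OF assms] has_derivative_ident]
  by (simp add: residual_def[abs_def])

text \<open>Derivatives are unique, so the Jacobian of the residual is that of \<open>g\<close>
  minus the identity.\<close>

lemma jacobian_residual_mult:
  assumes "g differentiable (at z)"
  shows "jacobian (residual g) (at z) *v h = jacobian g (at z) *v h - h"
proof -
  note D = residual_has_derivative[OF assms]
  then have "residual g differentiable (at z)"
    by (rule differentiableI)
  then have "(residual g has_derivative (*v) (jacobian (residual g) (at z))) (at z)"
    by (rule jacobian_works[THEN iffD1])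
  then show ?thesis
    using has_derivative_unique[OF D] by (simp add: fun_eq_iff)
qed

text \<open>Mean value inequality for the residual minus its linear part at \<open>z\<close>: on the
  ball of radius \<open>r\<close> around \<open>z\<close>, which contains the segment from
  \<open>a\<close> to \<open>b\<close>, the derivative of this difference has norm at most
  \<open>\<gamma> * r\<close>.\<close>

lemma norm_residual_linearization_le:
  fixes g :: "real^'d \<Rightarrow> real^'d"
  assumes diff: "\<And>z. g differentiable (at z)"
    and lip: "\<And>y z. spectral_norm (jacobian g (at y) - jacobian g (at z)) \<le> \<gamma> * norm (y - z)"
    and "0 \<le> \<gamma>" and a: "norm (a - z) \<le> r" and b: "norm (b - z) \<le> r"
  shows "norm (residual g b - residual g a - jacobian (residual g) (at z) *v (b - a))
           \<le> norm (b - a) * (\<gamma> * r)"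
proof -
  let ?F = "\<lambda>y h. jacobian g (at y) *v h - h"
  have "norm (residual g b - residual g a - ?F z (b - a)) \<le> norm (b - a) * (\<gamma> * r)"
  proof (rule differentiable_bound_linearization[where S = "cball z r" and f' = ?F])
    show "a + t *\<^sub>R (b - a) \<in> cball z r" if "t \<in> {0..1}" for t
    proof -
      have "(1 - t) *\<^sub>R a + t *\<^sub>R b \<in> cball z r"
        using that a b by (intro convexD[OF convex_cball]) (auto simp: dist_norm norm_minus_commute)
      then show ?thesis
        by (simp add: algebra_simps)
    qed
    show "(residual g has_derivative ?F y) (at y within cball z r)" for y
      by (rule has_derivative_at_withinI, rule residual_has_derivative, rule diff)
    show "onorm (?F y - ?F z) \<le> \<gamma> * r" if "y \<in> cball z r" for y
    proof -
      \<comment> \<open>The identity parts cancel, which makes the Lipschitz bound for the Jacobian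
        of \<open>g\<close> applicable.\<close>
      have "?F y - ?F z = (*v) (jacobian g (at y) - jacobian g (at z))"
        by (simp add: fun_eq_iff matrix_vector_mult_diff_rdistrib)
      then have "onorm (?F y - ?F z) \<le> \<gamma> * norm (y - z)"
        using lip[of y z] by (simp add: spectral_norm_def)
      also have "\<dots> \<le> \<gamma> * r"
        using that \<open>0 \<le> \<gamma>\<close> by (intro mult_left_mono) (auto simp: dist_norm norm_minus_commute)
      finally show ?thesis .
    qed
    have "0 \<le> r"
      using a norm_ge_zero order_trans by blast
    then show "z \<in> cball z r"
      by simp
  qed
  then show ?thesis
    by (simp add: jacobian_residual_mult[OF diff])
qed

text \<open>Each column of the defect is the linearization error between two consecutive Picard
  iterates, whose difference is the matching column of \<open>S\<close>.\<close>

lemma spectral_norm_secant_defect_le: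
  fixes g :: "real^'d \<Rightarrow> real^'d" and z :: "real^'d"
  defines "S \<equiv> S_matrix g z :: real^('m::{finite,linorder})^'d"
  assumes diff: "\<And>z. g differentiable (at z)"
    and nonexp: "\<And>y z. norm (g y - g z) \<le> norm (y - z)"
    and lip: "\<And>y z. spectral_norm (jacobian g (at y) - jacobian g (at z)) \<le> \<gamma> * norm (y - z)"
    and "0 \<le> \<gamma>"
  shows "spectral_norm (Y_matrix g z - jacobian (residual g) (at z) ** S)
           \<le> real CARD('m) * (spectral_norm S * (\<gamma> * (real CARD('m) * norm (residual g z))))"
proof (rule spectral_norm_le_columns)
  fix j :: 'm
  let ?J = "jacobian (residual g) (at z)"
  let ?a = "picard g z (index_pos j)" and ?b = "picard g z (Suc (index_pos j))"
  let ?r = "real CARD('m) * norm (residual g z)"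
  \<comment> \<open>The case \<open>l = CARD('m)\<close> is included: the last column involves the
    iterate with that index.\<close>
  have r: "norm (picard g z l - z) \<le> ?r" if "l \<le> CARD('m)" for l
    using norm_picard_diff_le[of g z l, OF nonexp] that
    by (meson mult_right_mono norm_ge_zero of_nat_mono order_trans)
  have col_S: "column j S = ?b - ?a"
    by (simp add: S_def S_matrix_def column_def vec_eq_iff)
  have "column j (Y_matrix g z - ?J ** S) = column j (Y_matrix g z) - ?J *v column j S"
    by (simp add: column_def vec_eq_iff matrix_matrix_mult_def matrix_vector_mult_def)
  also have "column j (Y_matrix g z) = residual g ?b - residual g ?a"
    by (simp add: Y_matrix_def column_def vec_eq_iff)
  finally have "norm (column j (Y_matrix g z - ?J ** S)) \<le> norm (?b - ?a) * (\<gamma> * ?r)"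
    using norm_residual_linearization_le[OF diff lip \<open>0 \<le> \<gamma>\<close> r r, of "index_pos j" "Suc (index_pos j)"]
      index_pos_less[of j]
    by (simp add: col_S)
  \<comment> \<open>Keeping the norm of \<open>S\<close> as a factor lets it pair later with the
    norm of its pseudoinverse.\<close>
  also have "\<dots> \<le> spectral_norm S * (\<gamma> * ?r)"
    using norm_column_le_onorm[of j S] \<open>0 \<le> \<gamma>\<close>
    by (intro mult_right_mono) (auto simp: col_S spectral_norm_def)
  finally show "norm (column j (Y_matrix g z - ?J ** S)) \<le> spectral_norm S * (\<gamma> * ?r)" .
qed

section \<open>Convergence of the error matrices\<close>

theorem corollary4p3:
  fixes g :: "real^'d \<Rightarrow> real^'d"
    and x :: "nat \<Rightarrow> real^'d"
    and \<beta> :: "nat \<Rightarrow> real"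
    and \<kappa> \<gamma> T M :: real
    and S Y :: "nat \<Rightarrow> real^('m::{finite,linorder})^'d"
    and J B E :: "nat \<Rightarrow> real^'d^'d"
  defines "S \<equiv> \<lambda>t. S_matrix g (x t)"
    and "Y \<equiv> \<lambda>t. Y_matrix g (x t)"
    and "J \<equiv> \<lambda>t. jacobian (residual g) (at (x t))"
    and "B \<equiv> \<lambda>t. B_star (S t) (Y t) (J t)"
    and "E \<equiv> \<lambda>t. B t - J t"
  assumes "CARD('m) \<le> CARD('d)"
    and "\<forall>z. g differentiable (at z)"
    and "continuous_on UNIV (\<lambda>z. jacobian g (at z))"
    and "\<forall>y z. norm (g y - g z) \<le> \<kappa> * norm (y - z)" and "\<kappa> \<le> 1"
    and "\<forall>y z. spectral_norm (jacobian g (at y) - jacobian g (at z)) \<le> \<gamma> * norm (y - z)"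
    and "\<gamma> > 0"
    and "\<forall>t. \<beta> t \<ge> 0"
    and "AAP_sequence g CARD('m) \<beta> x"
    and "\<forall>t. rank (S t) = CARD('m) \<and> rank (Y t) = CARD('m)"
    and "T > 0" and "M > 0"
    and "\<forall>t. real t > T \<longrightarrow> cond_number (S t) \<le> M"
    and "(\<lambda>t. residual g (x t)) \<longlonglongrightarrow> 0"
  shows "E \<longlonglongrightarrow> 0 \<and> (\<lambda>t. spectral_norm (B t - J t)) \<longlonglongrightarrow> 0"
proof -
  let ?m = "real CARD('m)"
  have nonexp: "norm (g y - g z) \<le> norm (y - z)" for y z
    using assms(9)[rule_format, of y z] mult_right_mono[OF assms(10) norm_ge_zero[of "y - z"]] by simp
  have inj: "inj ((*v) (S t))" for t
    using assms(15) by (simp flip: full_rank_injective)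
  \<comment> \<open>One factor \<open>?m\<close> counts the columns; the other comes from the radius
    of the ball containing the iterates.\<close>
  have E_le: "spectral_norm (E t) \<le> ?m * ?m * \<gamma> * norm (residual g (x t)) * cond_number (S t)" for t
  proof -
    let ?D = "Y t - J t ** S t" and ?c = "?m * ?m * \<gamma> * norm (residual g (x t))"
    have "spectral_norm (E t) \<le> spectral_norm ?D * spectral_norm (left_pinv (S t))"
      unfolding E_def B_def B_star_diff[OF inj] by (rule spectral_norm_mult)
    also have "spectral_norm ?D \<le> ?c * spectral_norm (S t)"
      using spectral_norm_secant_defect_le[of g \<gamma> "x t", where 'm = 'm] assms(7,11,12) nonexp
      by (simp add: S_def Y_def J_def mult_ac)
    finally have "spectral_norm (E t) \<le> ?c * (spectral_norm (S t) * spectral_norm (left_pinv (S t)))"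
      by (simp add: mult_right_mono spectral_norm_nonneg mult_ac)
    also have "\<dots> \<le> ?c * cond_number (S t)"
      using assms(12) by (intro mult_left_mono spectral_norm_mult_left_pinv_le_cond_number inj) simp
    finally show ?thesis .
  qed
  \<comment> \<open>The condition number is bounded by \<open>M\<close> only beyond
    \<open>T\<close>, so the comparison is made eventually.\<close>
  have "\<forall>\<^sub>F t in sequentially. real t > T"
    using filterlim_real_sequentially by (simp add: filterlim_at_top_dense)
  then have "\<forall>\<^sub>F t in sequentially. norm (spectral_norm (E t)) \<le> ?m * ?m * \<gamma> * norm (residual g (x t)) * M"
  proof eventually_elim
    case (elim t)
    then have "cond_number (S t) \<le> M"
      using assms(18) by simp
    then have "?m * ?m * \<gamma> * norm (residual g (x t)) * cond_number (S t)
                 \<le> ?m * ?m * \<gamma> * norm (residual g (x t)) * M"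
      using assms(12) by (intro mult_left_mono) simp_all
    then show ?case
      unfolding real_norm_def abs_of_nonneg[OF spectral_norm_nonneg]
      using E_le[of t] by linarith
  qed
  moreover have "(\<lambda>t. ?m * ?m * \<gamma> * norm (residual g (x t)) * M) \<longlonglongrightarrow> 0"
    using assms(19) by (intro tendsto_mult_left_zero tendsto_mult_right_zero tendsto_norm_zero)
  ultimately have "(\<lambda>t. spectral_norm (E t)) \<longlonglongrightarrow> 0"
    by (rule Lim_null_comparison)
  \<comment> \<open>The scalar limit is the second claim; it gives the first entrywise.\<close>
  then show ?thesis
    using spectral_norm_tendsto_zero_imp by (simp add: E_def)
qed

end
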